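(* Let $\Gamma$ be a finite group with right regular representation $\{R_g\}_{g\in\Gamma}$. A binary Parseval frame $\mathcal F=\{f_g\}_{g\in\Gamma}$ indexed by $\Gamma$ is a $\Gamma$-frame if and only if its Gramian is in the algebra $\mathbb Z_2[\{R_g\}_{g\in\Gamma}]$.
   Context: All vectors and matrices are over the field $\mathbb Z_2$ with two elements. The dot product on $\mathbb Z_2^n$ is $\langle a,b\rangle=\sum_{i=1}^n a_ib_i\in\mathbb Z_2$. A finite family $\{f_j\}_{j\in J}$ in $\mathbb Z_2^n$ is a binary Parseval frame if $x=\sum_{j\in J}\langle x,f_j\rangle f_j$ for all $x\in\mathbb Z_2^n$. For a finite group $\Gamma$ with identity $e$, a family $\{f_g\}_{g\in\Gamma}$ spanning $\mathbb Z_2^n$ is a $\Gamma$-frame if there is a representation (group homomorphism) $\rho:\Gamma\to \mathrm{GL}(\mathbb Z_2^n)$ with $f_g=\rho(g)f_e$ for all $g\in\Gamma$. The Gramian of $\{f_g\}_{g\in\Gamma}$ is the linear map $G:\mathbb Z_2^\Gamma\to\mathbb Z_2^\Gamma$ with matrix entries $G_{a,b}=\langle f_b,f_a\rangle$ in the standard basis. The right regular representation acts on functions $\varphi:\Gamma\to\mathbb Z_2$ by $(R_g\varphi)(h)=\varphi(hg)$. $\mathbb Z_2[\{R_g\}_{g\in\Gamma}]$ is the set of all $\mathbb Z_2$-linear combinations of the $R_g$. *)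

theory Defs
  imports
    "HOL-Analysis.Cartesian_Space"
    "HOL-Algebra.Group"
    "HOL-Library.FuncSet"
    "HOL-Library.Z2"
begin

definition dotp :: "bit ^ 'n \<Rightarrow> bit ^ 'n \<Rightarrow> bit" where
  "dotp a b = (\<Sum>i\<in>UNIV. a $ i * b $ i)"

definition binary_parseval_frame :: "'j set \<Rightarrow> ('j \<Rightarrow> bit ^ 'n) \<Rightarrow> bool" where
  "binary_parseval_frame J f \<longleftrightarrow>
     finite J \<and> (\<forall>x. x = (\<Sum>j\<in>J. dotp x (f j) *s f j))"

text \<open>Linear automorphisms of the space of binary column vectors are identified with their
  matrices in the standard basis.\<close>

definition GL :: "(bit ^ 'n ^ 'n) monoid" where
  "GL = \<lparr>carrier = {A. invertible A}, mult = (**), one = mat 1\<rparr>"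

lemma group_GL: "group (GL :: (bit ^ 'n ^ 'n) monoid)"
proof (rule groupI)
  fix A :: "bit ^ 'n ^ 'n"
  assume "A \<in> carrier GL"
  then obtain B where "A ** B = mat 1" "B ** A = mat 1"
    by (auto simp: GL_def invertible_def)
  then show "\<exists>B\<in>carrier GL. B \<otimes>\<^bsub>GL\<^esub> A = \<one>\<^bsub>GL\<^esub>"
    by (auto simp: GL_def invertible_def)
qed (auto simp: GL_def invertible_mult matrix_mul_assoc, simp add: invertible_def)

definition group_frame :: "('g, 'm) monoid_scheme \<Rightarrow> ('g \<Rightarrow> bit ^ 'n) \<Rightarrow> bool" where
  "group_frame \<Gamma> f \<longleftrightarrow>
     vec.span (f ` carrier \<Gamma>) = UNIV \<and>
     (\<exists>\<rho> \<in> hom \<Gamma> GL. \<forall>g\<in>carrier \<Gamma>. f g = \<rho> g *v f \<one>\<^bsub>\<Gamma>\<^esub>)"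

text \<open>The space of binary functions on \<open>J\<close>. Its elements are \<open>undefined\<close> outside \<open>J\<close>, and operators
  on it are \<open>undefined\<close> outside the space, so that HOL equality of operators is
  equality as maps on the space.\<close>

definition bitfun :: "'j set \<Rightarrow> ('j \<Rightarrow> bit) set" where
  "bitfun J = J \<rightarrow>\<^sub>E UNIV"

definition gramian :: "'j set \<Rightarrow> ('j \<Rightarrow> bit ^ 'n) \<Rightarrow> ('j \<Rightarrow> bit) \<Rightarrow> ('j \<Rightarrow> bit)" where
  "gramian J f = (\<lambda>\<phi>\<in>bitfun J. \<lambda>a\<in>J. \<Sum>b\<in>J. dotp (f b) (f a) * \<phi> b)"

definition right_regular ::
    "('g, 'm) monoid_scheme \<Rightarrow> 'g \<Rightarrow> ('g \<Rightarrow> bit) \<Rightarrow> ('g \<Rightarrow> bit)" where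
  "right_regular \<Gamma> g = (\<lambda>\<phi>\<in>bitfun (carrier \<Gamma>). \<lambda>h\<in>carrier \<Gamma>. \<phi> (h \<otimes>\<^bsub>\<Gamma>\<^esub> g))"

definition right_regular_algebra ::
    "('g, 'm) monoid_scheme \<Rightarrow> (('g \<Rightarrow> bit) \<Rightarrow> ('g \<Rightarrow> bit)) set" where
  "right_regular_algebra \<Gamma> =
     {(\<lambda>\<phi>\<in>bitfun (carrier \<Gamma>). \<lambda>h\<in>carrier \<Gamma>. \<Sum>g\<in>carrier \<Gamma>. c g * right_regular \<Gamma> g \<phi> h)
      | c :: 'g \<Rightarrow> bit. True}"

end

theory Submission imports Defs begin

text \<open>Both sides are equivalent to left invariance of the Gram matrix, that is,
  \<open>\<langle>f\<^bsub>gb\<^esub>, f\<^bsub>ga\<^esub>\<rangle> = \<langle>f\<^bsub>b\<^esub>, f\<^bsub>a\<^esub>\<rangle>\<close>. An operator lies in the right regular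
  algebra iff its \<open>(a, b)\<close> matrix entry depends only on \<open>a\<^sup>-\<^sup>1b\<close>. If \<open>f\<close> is a Parseval
  \<open>\<Gamma>\<close>-frame, then each \<open>\<rho>(g)\<close> permutes the frame, so conjugating the Parseval identity by
  \<open>\<rho>(g)\<close> shows that \<open>\<rho>(g)\<close> is orthogonal. Conversely, for an invariant Gram matrix the maps
  \<open>x \<mapsto> \<Sum>\<^sub>j \<langle>x, f\<^sub>j\<rangle> f\<^bsub>gj\<^esub>\<close> form a representation that translates the frame.\<close>

lemma dotp_matrix_vector: "dotp (A *v x) y = dotp x (transpose A *v y)"
proof -
  have "dotp (A *v x) y = (\<Sum>i\<in>UNIV. \<Sum>j\<in>UNIV. A $ i $ j * x $ j * y $ i)"
    by (simp only: dotp_def matrix_vector_mult_def vec_lambda_beta sum_distrib_right)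
  also have "\<dots> = (\<Sum>j\<in>UNIV. \<Sum>i\<in>UNIV. A $ i $ j * x $ j * y $ i)"
    by (rule sum.swap)
  also have "\<dots> = dotp x (transpose A *v y)"
    by (simp only: dotp_def matrix_vector_mult_def transpose_def vec_lambda_beta
        sum_distrib_left mult_ac)
  finally show ?thesis .
qed

lemma dotp_add_left: "dotp (x + y) z = dotp x z + dotp y z"
  by (simp only: dotp_def vector_add_component distrib_right sum.distrib)

lemma dotp_scale_left: "dotp (c *s x) y = c * dotp x y"
  by (simp only: dotp_def vector_smult_component sum_distrib_left mult.assoc)

text \<open>Lets \<open>matrix_works\<close> turn such a map into a matrix. The vectors
  \<open>h j\<close> are kept separate from \<open>f j\<close> because the converse takes for
  \<open>h\<close> a translate of the frame.\<close>

lemma linear_sum_dotp: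
  "Vector_Spaces.linear (*s) (*s) (\<lambda>x. \<Sum>j\<in>J. dotp x (f j) *s h j)"
  by unfold_locales
    (simp_all only: dotp_add_left dotp_scale_left vec.scale_left_distrib sum.distrib
      vec.scale_sum_right vec.scale_scale)

lemma (in group) sum_left_translate:
  assumes "a \<in> carrier G"
  shows "(\<Sum>x\<in>carrier G. F (a \<otimes> x)) = (\<Sum>x\<in>carrier G. F x)"
  by (rule sum.reindex_bij_witness[of _ "\<lambda>x. inv a \<otimes> x" "\<lambda>x. a \<otimes> x"])
    (use assms in \<open>auto simp: m_assoc[symmetric]\<close>)

definition gram_left_invariant ::
    "('g, 'm) monoid_scheme \<Rightarrow> ('g \<Rightarrow> bit ^ 'n) \<Rightarrow> bool" where
  "gram_left_invariant \<Gamma> f \<longleftrightarrow>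
     (\<forall>g\<in>carrier \<Gamma>. \<forall>a\<in>carrier \<Gamma>. \<forall>b\<in>carrier \<Gamma>.
        dotp (f (g \<otimes>\<^bsub>\<Gamma>\<^esub> b)) (f (g \<otimes>\<^bsub>\<Gamma>\<^esub> a)) = dotp (f b) (f a))"

text \<open>Since \<open>right_regular \<Gamma> g\<close> evaluates at \<open>a\<close> by reading
  the argument at \<open>a g\<close>, a combination with coefficients \<open>c\<close> has matrix
  entry \<open>c (inv a b)\<close> in row \<open>a\<close> and column \<open>b\<close>.\<close>

lemma gramian_in_right_regular_algebra_iff:
  fixes \<Gamma> :: "('g, 'm) monoid_scheme" and f :: "'g \<Rightarrow> bit ^ 'n"
  assumes "group \<Gamma>" and fin: "finite (carrier \<Gamma>)"
  shows "gramian (carrier \<Gamma>) f \<in> right_regular_algebra \<Gamma> \<longleftrightarrow> gram_left_invariant \<Gamma> f"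
proof
  interpret group \<Gamma> by fact
  assume "gramian (carrier \<Gamma>) f \<in> right_regular_algebra \<Gamma>"
  then obtain c :: "'g \<Rightarrow> bit" where c: "gramian (carrier \<Gamma>) f =
      (\<lambda>\<phi>\<in>bitfun (carrier \<Gamma>). \<lambda>h\<in>carrier \<Gamma>. \<Sum>g\<in>carrier \<Gamma>. c g * right_regular \<Gamma> g \<phi> h)"
    unfolding right_regular_algebra_def by blast
  have entry: "dotp (f b) (f a) = c (inv\<^bsub>\<Gamma>\<^esub> a \<otimes>\<^bsub>\<Gamma>\<^esub> b)"
    if a: "a \<in> carrier \<Gamma>" and b: "b \<in> carrier \<Gamma>" for a b
  proof -
    \<comment> \<open>The point mass at \<open>b\<close> extracts column \<open>b\<close> of an
      operator; restricting it to the carrier makes it an element of \<open>bitfun\<close>.\<close>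
    define \<delta> :: "'g \<Rightarrow> bit" where "\<delta> = (\<lambda>x\<in>carrier \<Gamma>. if x = b then 1 else 0)"
    have \<delta>: "\<delta> \<in> bitfun (carrier \<Gamma>)"
      by (simp add: \<delta>_def bitfun_def)
    have "dotp (f b) (f a) = (\<Sum>x\<in>carrier \<Gamma>. if x = b then dotp (f x) (f a) else 0)"
      using fin b by simp
    also have "\<dots> = gramian (carrier \<Gamma>) f \<delta> a"
      using \<delta> a by (auto simp: gramian_def \<delta>_def intro!: sum.cong)
    also have "\<dots> = (\<Sum>g\<in>carrier \<Gamma>. c g * \<delta> (a \<otimes>\<^bsub>\<Gamma>\<^esub> g))"
      using \<delta> a by (simp add: c right_regular_def)
    also have "\<dots> = (\<Sum>g\<in>carrier \<Gamma>. if g = inv\<^bsub>\<Gamma>\<^esub> a \<otimes>\<^bsub>\<Gamma>\<^esub> b then c g else 0)"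
      using a b by (auto simp: \<delta>_def inv_solve_left intro!: sum.cong)
    also have "\<dots> = c (inv\<^bsub>\<Gamma>\<^esub> a \<otimes>\<^bsub>\<Gamma>\<^esub> b)"
      using fin a b by simp
    finally show ?thesis .
  qed
  show "gram_left_invariant \<Gamma> f"
    unfolding gram_left_invariant_def
  proof (intro ballI)
    fix g a b assume g: "g \<in> carrier \<Gamma>" and a: "a \<in> carrier \<Gamma>" and b: "b \<in> carrier \<Gamma>"
    have "inv\<^bsub>\<Gamma>\<^esub> (g \<otimes>\<^bsub>\<Gamma>\<^esub> a) \<otimes>\<^bsub>\<Gamma>\<^esub> (g \<otimes>\<^bsub>\<Gamma>\<^esub> b) = inv\<^bsub>\<Gamma>\<^esub> a \<otimes>\<^bsub>\<Gamma>\<^esub> b"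
      using g a b by (simp add: inv_mult_group m_assoc inv_solve_left')
    then show "dotp (f (g \<otimes>\<^bsub>\<Gamma>\<^esub> b)) (f (g \<otimes>\<^bsub>\<Gamma>\<^esub> a)) = dotp (f b) (f a)"
      using g a b by (simp add: entry)
  qed
next
  interpret group \<Gamma> by fact
  assume inv: "gram_left_invariant \<Gamma> f"
  \<comment> \<open>The coefficients are the Gram matrix row of the identity. Substituting
    \<open>b = a g\<close> and cancelling \<open>a\<close> by invariance brings row \<open>a\<close>
    to this form.\<close>
  have "(\<Sum>b\<in>carrier \<Gamma>. dotp (f b) (f a) * \<phi> b) =
      (\<Sum>g\<in>carrier \<Gamma>. dotp (f g) (f \<one>\<^bsub>\<Gamma>\<^esub>) * right_regular \<Gamma> g \<phi> a)"
    if \<phi>: "\<phi> \<in> bitfun (carrier \<Gamma>)" and a: "a \<in> carrier \<Gamma>" for \<phi> a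
  proof -
    have "dotp (f (a \<otimes>\<^bsub>\<Gamma>\<^esub> g)) (f a) = dotp (f g) (f \<one>\<^bsub>\<Gamma>\<^esub>)" if "g \<in> carrier \<Gamma>" for g
      using inv[unfolded gram_left_invariant_def, rule_format, OF a one_closed that] a by simp
    then have "(\<Sum>g\<in>carrier \<Gamma>. dotp (f (a \<otimes>\<^bsub>\<Gamma>\<^esub> g)) (f a) * \<phi> (a \<otimes>\<^bsub>\<Gamma>\<^esub> g)) =
        (\<Sum>g\<in>carrier \<Gamma>. dotp (f g) (f \<one>\<^bsub>\<Gamma>\<^esub>) * right_regular \<Gamma> g \<phi> a)"
      using \<phi> a by (simp add: right_regular_def)
    then show ?thesis
      using sum_left_translate[OF a, of "\<lambda>b. dotp (f b) (f a) * \<phi> b"] by simp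
  qed
  then have "gramian (carrier \<Gamma>) f =
      (\<lambda>\<phi>\<in>bitfun (carrier \<Gamma>). \<lambda>h\<in>carrier \<Gamma>.
        \<Sum>g\<in>carrier \<Gamma>. dotp (f g) (f \<one>\<^bsub>\<Gamma>\<^esub>) * right_regular \<Gamma> g \<phi> h)"
    unfolding gramian_def by (intro restrict_ext) simp
  then show "gramian (carrier \<Gamma>) f \<in> right_regular_algebra \<Gamma>"
    unfolding right_regular_algebra_def
    by (intro CollectI exI[of _ "\<lambda>g. dotp (f g) (f \<one>\<^bsub>\<Gamma>\<^esub>)"] conjI TrueI)
qed

lemma group_frame_imp_gram_left_invariant:
  fixes \<Gamma> :: "('g, 'm) monoid_scheme" and f :: "'g \<Rightarrow> bit ^ 'n"
  assumes "group \<Gamma>" and "binary_parseval_frame (carrier \<Gamma>) f" and "group_frame \<Gamma> f"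
  shows "gram_left_invariant \<Gamma> f"
proof -
  interpret group \<Gamma> by fact
  have parseval: "(\<Sum>j\<in>carrier \<Gamma>. dotp x (f j) *s f j) = x" for x
    using assms(2) unfolding binary_parseval_frame_def by metis
  obtain \<rho> where \<rho>: "\<rho> \<in> hom \<Gamma> GL" and f: "\<And>g. g \<in> carrier \<Gamma> \<Longrightarrow> f g = \<rho> g *v f \<one>\<^bsub>\<Gamma>\<^esub>"
    using assms(3) unfolding group_frame_def by auto
  have trans: "f (g \<otimes>\<^bsub>\<Gamma>\<^esub> h) = \<rho> g *v f h" if "g \<in> carrier \<Gamma>" "h \<in> carrier \<Gamma>" for g h
  proof -
    have "\<rho> (g \<otimes>\<^bsub>\<Gamma>\<^esub> h) = \<rho> g ** \<rho> h"
      using hom_mult[OF \<rho> that] by (simp add: GL_def)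
    then show ?thesis
      using that f[of h] f[of "g \<otimes>\<^bsub>\<Gamma>\<^esub> h"] by (simp add: matrix_vector_mul_assoc)
  qed
  have orth: "transpose (\<rho> g) ** \<rho> g = mat 1" if g: "g \<in> carrier \<Gamma>" for g
  proof -
    \<comment> \<open>Expand the transpose's value at \<open>x\<close> by Parseval and apply
      \<open>\<rho> g\<close> termwise. Moving the transpose across the dot product leaves the
      Parseval sum for \<open>x\<close> over the frame permuted by \<open>g\<close>.\<close>
    have "(\<rho> g ** transpose (\<rho> g)) *v x = x" for x
    proof -
      have "(\<rho> g ** transpose (\<rho> g)) *v x =
          \<rho> g *v (\<Sum>j\<in>carrier \<Gamma>. dotp (transpose (\<rho> g) *v x) (f j) *s f j)"
        by (simp only: parseval matrix_vector_mul_assoc)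
      also have "\<dots> = (\<Sum>j\<in>carrier \<Gamma>. dotp x (\<rho> g *v f j) *s (\<rho> g *v f j))"
        by (simp only: vec.sum vec.scale dotp_matrix_vector transpose_transpose)
      also have "\<dots> = (\<Sum>j\<in>carrier \<Gamma>. dotp x (f (g \<otimes>\<^bsub>\<Gamma>\<^esub> j)) *s f (g \<otimes>\<^bsub>\<Gamma>\<^esub> j))"
        by (intro sum.cong refl) (simp add: trans g)
      also have "\<dots> = x"
        using sum_left_translate[OF g, of "\<lambda>j. dotp x (f j) *s f j"] by (simp add: parseval)
      finally show ?thesis .
    qed
    then have "\<rho> g ** transpose (\<rho> g) = mat 1"
      by (simp add: matrix_eq)
    \<comment> \<open>For square matrices a right inverse is a left inverse. The order matters:
      Parseval gives \<open>\<rho> g ** transpose (\<rho> g)\<close>, while comparing dot products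
      of translated vectors needs the opposite product.\<close>
    then show ?thesis
      by (simp add: matrix_left_right_inverse)
  qed
  show ?thesis
    unfolding gram_left_invariant_def
    by (simp add: trans dotp_matrix_vector matrix_vector_mul_assoc orth)
qed

lemma gram_left_invariant_imp_group_frame:
  fixes \<Gamma> :: "('g, 'm) monoid_scheme" and f :: "'g \<Rightarrow> bit ^ 'n"
  assumes "group \<Gamma>" and "binary_parseval_frame (carrier \<Gamma>) f" and "gram_left_invariant \<Gamma> f"
  shows "group_frame \<Gamma> f"
proof -
  interpret group \<Gamma> by fact
  have parseval: "(\<Sum>j\<in>carrier \<Gamma>. dotp x (f j) *s f j) = x" for x
    using assms(2) unfolding binary_parseval_frame_def by metis
  \<comment> \<open>Frame vectors may be linearly dependent, so sending each \<open>f j\<close> to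
    its translate need not extend linearly. Translating the vectors in the Parseval expansion of
    \<open>x\<close>, with its coefficients kept, is linear from the outset.\<close>
  define \<rho> where "\<rho> g = matrix (\<lambda>x. \<Sum>j\<in>carrier \<Gamma>. dotp x (f j) *s f (g \<otimes>\<^bsub>\<Gamma>\<^esub> j))" for g
  have \<rho>: "\<rho> g *v x = (\<Sum>j\<in>carrier \<Gamma>. dotp x (f j) *s f (g \<otimes>\<^bsub>\<Gamma>\<^esub> j))" for g x
    unfolding \<rho>_def by (rule matrix_works[OF linear_sum_dotp])
  have trans: "\<rho> g *v f b = f (g \<otimes>\<^bsub>\<Gamma>\<^esub> b)" if g: "g \<in> carrier \<Gamma>" and b: "b \<in> carrier \<Gamma>" for g b
  proof -
    \<comment> \<open>Invariance rewrites the coefficients so that the sum becomes the Parseval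
      expansion of the translated vector, reindexed by \<open>g\<close>.\<close>
    have "\<rho> g *v f b =
        (\<Sum>j\<in>carrier \<Gamma>. dotp (f (g \<otimes>\<^bsub>\<Gamma>\<^esub> b)) (f (g \<otimes>\<^bsub>\<Gamma>\<^esub> j)) *s f (g \<otimes>\<^bsub>\<Gamma>\<^esub> j))"
      unfolding \<rho> using assms(3) g b by (simp add: gram_left_invariant_def)
    also have "\<dots> = f (g \<otimes>\<^bsub>\<Gamma>\<^esub> b)"
      using sum_left_translate[OF g, of "\<lambda>j. dotp (f (g \<otimes>\<^bsub>\<Gamma>\<^esub> b)) (f j) *s f j"]
      by (simp add: parseval)
    finally show ?thesis .
  qed
  have mult: "\<rho> (g \<otimes>\<^bsub>\<Gamma>\<^esub> h) = \<rho> g ** \<rho> h" if "g \<in> carrier \<Gamma>" "h \<in> carrier \<Gamma>" for g h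
  proof -
    have "\<rho> g *v (\<rho> h *v x) = \<rho> (g \<otimes>\<^bsub>\<Gamma>\<^esub> h) *v x" for x
      \<comment> \<open>Only \<open>\<rho> h\<close> and the product's matrix are expanded;
        \<open>\<rho> g\<close> stays folded so that \<open>trans\<close> can move it through the
        sum.\<close>
      unfolding \<rho>[of h] \<rho>[of "g \<otimes>\<^bsub>\<Gamma>\<^esub> h"] using that
      by (simp add: vec.sum vec.scale trans m_assoc)
    then show ?thesis
      by (simp add: matrix_eq matrix_vector_mul_assoc)
  qed
  have one: "\<rho> \<one>\<^bsub>\<Gamma>\<^esub> = mat 1"
    by (simp add: matrix_eq \<rho> parseval)
  have "invertible (\<rho> g)" if "g \<in> carrier \<Gamma>" for g
    unfolding invertible_def using that mult[of g "inv\<^bsub>\<Gamma>\<^esub> g"] mult[of "inv\<^bsub>\<Gamma>\<^esub> g" g] one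
    by (intro exI[of _ "\<rho> (inv\<^bsub>\<Gamma>\<^esub> g)"]) simp
  then have "\<rho> \<in> hom \<Gamma> GL"
    by (auto simp: hom_def GL_def mult)
  moreover have "\<forall>g\<in>carrier \<Gamma>. f g = \<rho> g *v f \<one>\<^bsub>\<Gamma>\<^esub>"
    by (simp add: trans)
  moreover have "x \<in> vec.span (f ` carrier \<Gamma>)" for x
  proof -
    have "(\<Sum>j\<in>carrier \<Gamma>. dotp x (f j) *s f j) \<in> vec.span (f ` carrier \<Gamma>)"
      by (intro vec.span_sum vec.span_scale vec.span_base imageI)
    then show ?thesis
      by (simp add: parseval)
  qed
  ultimately show ?thesis
    unfolding group_frame_def by blast
qed

theorem corollary3p3:
  fixes \<Gamma> :: "('g, 'm) monoid_scheme" and f :: "'g \<Rightarrow> bit ^ 'n"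
  assumes "group \<Gamma>" and "finite (carrier \<Gamma>)"
    and "binary_parseval_frame (carrier \<Gamma>) f"
  shows "group_frame \<Gamma> f \<longleftrightarrow> gramian (carrier \<Gamma>) f \<in> right_regular_algebra \<Gamma>"
  using assms gramian_in_right_regular_algebra_iff group_frame_imp_gram_left_invariant
    gram_left_invariant_imp_group_frame by metis

end
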